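(* Let $P$ be a probability measure on $\mathcal X$ with $P\ll P_0$ and $u:=\frac{dP}{dP_0}-1\in L^2(P_0)$. Then $$D_{\mathrm{KSD}}^2(P,P_0)=\langle \mathfrak J^*u,\mathfrak J^*u\rangle_{\mathscr H_{K_0}}=\langle \Upsilon_{P_0}u,u\rangle_{L^2(P_0)}=\sum_{i\ge 1}\lambda_i\,\langle u,\tilde\phi_i\rangle_{L^2(P_0)}^2 .$$
   Context: $(\mathcal X,\mathcal B)$ is a second countable topological space with its Borel $\sigma$-algebra and $P_0$ is a probability measure on it. $\mathscr H$ is a Hilbert space and $x\mapsto\psi_{P_0}(\cdot,x)\in\mathscr H$ is a map ($x\in\mathcal X$) with mean zero under $P_0$: $\mathbb E_{P_0}\psi_{P_0}(\cdot,X)=0$ in $\mathscr H$. The Stein kernel is $K_0(x,y):=\langle\psi_{P_0}(\cdot,x),\psi_{P_0}(\cdot,y)\rangle_{\mathscr H}$, so $\mathbb E_{P_0}K_0(x,Y)=0$ for all $x$; $\mathscr H_{K_0}$ is its reproducing kernel Hilbert space (RKHS) of real-valued functions. Standing assumption: $K_0$ is continuous and $\int_{\mathcal X}K_0(x,x)\,dP_0(x)<\infty$. The kernel Stein discrepancy is $$D_{\mathrm{KSD}}(P,P_0):=\sup_{f\in\mathscr H,\ \|f\|_{\mathscr H}\le1}\left|\mathbb E_P\langle\psi_{P_0}(\cdot,X),f\rangle_{\mathscr H}\right|=\|\mathbb E_P\psi_{P_0}(\cdot,X)\|_{\mathscr H}=\sqrt{\mathbb E_{P\times P}K_0(X,Y)}.$$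 $\mathfrak J:\mathscr H_{K_0}\to L^2(P_0)$, $f\mapsto[f]_\sim$ is the inclusion operator; its adjoint is $\mathfrak J^*:L^2(P_0)\to\mathscr H_{K_0}$, $f\mapsto\int K_0(\cdot,x)f(x)\,dP_0(x)$. $\Upsilon_{P_0}:=\mathfrak J\mathfrak J^*:L^2(P_0)\to L^2(P_0)$ is the integral operator of $K_0$, and $(\lambda_i,\tilde\phi_i)_i$ are its positive eigenvalues and corresponding orthonormal eigenfunctions (spanning $\overline{\mathrm{Ran}(\Upsilon_{P_0})}$). *)

theory Defs
  imports "HOL-Probability.Probability"
begin

section \<open>Reproducing kernel Hilbert spaces of real-valued functions\<close>

text \<open>
  A Hilbert space of functions is a carrier set \<open>S\<close> with pointwise operations and an inner product
  \<open>ip\<close> that is only meaningful on \<open>S\<close>. For a given kernel \<open>K\<close> the pair (\<open>S\<close>, \<open>ip\<close> restricted to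
  \<open>S\<close>) is unique by the Moore-Aronszajn theorem, so "the RKHS of \<open>K\<close>" is rendered as any pair
  satisfying \<open>is_rkhs K S ip\<close>.
\<close>

definition is_hilbert_function_space ::
  "('a \<Rightarrow> real) set \<Rightarrow> (('a \<Rightarrow> real) \<Rightarrow> ('a \<Rightarrow> real) \<Rightarrow> real) \<Rightarrow> bool" where
  "is_hilbert_function_space S ip \<longleftrightarrow>
     (\<lambda>x. 0) \<in> S \<and>
     (\<forall>f\<in>S. \<forall>g\<in>S. (\<lambda>x. f x + g x) \<in> S) \<and>
     (\<forall>c. \<forall>f\<in>S. (\<lambda>x. c * f x) \<in> S) \<and>
     (\<forall>f\<in>S. \<forall>g\<in>S. ip f g = ip g f) \<and>
     (\<forall>f\<in>S. \<forall>g\<in>S. \<forall>h\<in>S. ip (\<lambda>x. f x + g x) h = ip f h + ip g h) \<and>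
     (\<forall>c. \<forall>f\<in>S. \<forall>g\<in>S. ip (\<lambda>x. c * f x) g = c * ip f g) \<and>
     (\<forall>f\<in>S. 0 \<le> ip f f) \<and>
     (\<forall>f\<in>S. ip f f = 0 \<longrightarrow> f = (\<lambda>x. 0)) \<and>
     (\<forall>F :: nat \<Rightarrow> 'a \<Rightarrow> real.
        (\<forall>n. F n \<in> S) \<and>
        (\<forall>e>0. \<exists>N. \<forall>m\<ge>N. \<forall>n\<ge>N.
           sqrt (ip (\<lambda>x. F m x - F n x) (\<lambda>x. F m x - F n x)) < e)
        \<longrightarrow> (\<exists>f\<in>S. (\<lambda>n. sqrt (ip (\<lambda>x. F n x - f x) (\<lambda>x. F n x - f x))) \<longlonglongrightarrow> 0))"

definition is_rkhs ::
  "('a \<Rightarrow> 'a \<Rightarrow> real) \<Rightarrow> ('a \<Rightarrow> real) set \<Rightarrow> (('a \<Rightarrow> real) \<Rightarrow> ('a \<Rightarrow> real) \<Rightarrow> real) \<Rightarrow> bool" where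
  "is_rkhs K S ip \<longleftrightarrow>
     is_hilbert_function_space S ip \<and>
     (\<forall>x. (\<lambda>y. K y x) \<in> S) \<and>
     (\<forall>f\<in>S. \<forall>x. ip f (\<lambda>y. K y x) = f x)"


section \<open>The space of square integrable functions modulo almost everywhere equality\<close>

definition square_integrable :: "'a measure \<Rightarrow> ('a \<Rightarrow> real) set" where
  "square_integrable M = {f \<in> borel_measurable M. integrable M (\<lambda>x. (f x)\<^sup>2)}"

definition L2_class :: "'a measure \<Rightarrow> ('a \<Rightarrow> real) \<Rightarrow> ('a \<Rightarrow> real) set" where
  "L2_class M f = {g \<in> borel_measurable M. AE x in M. g x = f x}"

definition L2 :: "'a measure \<Rightarrow> ('a \<Rightarrow> real) set set" where
  "L2 M = L2_class M ` square_integrable M"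

text \<open>The value does not depend on the chosen representatives; see \<open>L2_inner_class\<close> below.\<close>

definition L2_inner :: "'a measure \<Rightarrow> ('a \<Rightarrow> real) set \<Rightarrow> ('a \<Rightarrow> real) set \<Rightarrow> real" where
  "L2_inner M A B = (\<integral>x. (SOME f. f \<in> A) x * (SOME g. g \<in> B) x \<partial>M)"

lemma L2_inner_class:
  assumes f: "f \<in> borel_measurable M" and g: "g \<in> borel_measurable M"
  shows "L2_inner M (L2_class M f) (L2_class M g) = (\<integral>x. f x * g x \<partial>M)"
proof -
  define f' where "f' = (SOME h. h \<in> L2_class M f)"
  define g' where "g' = (SOME h. h \<in> L2_class M g)"
  have "f \<in> L2_class M f" "g \<in> L2_class M g"
    using f g by (auto simp: L2_class_def)
  then have "f' \<in> L2_class M f" "g' \<in> L2_class M g"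
    unfolding f'_def g'_def by (metis someI)+
  then have f': "f' \<in> borel_measurable M" "AE x in M. f' x = f x"
    and g': "g' \<in> borel_measurable M" "AE x in M. g' x = g x"
    by (auto simp: L2_class_def)
  have "(\<integral>x. f' x * g' x \<partial>M) = (\<integral>x. f x * g x \<partial>M)"
  proof (rule integral_cong_AE)
    show "AE x in M. f' x * g' x = f x * g x"
      using f'(2) g'(2) by eventually_elim simp
  qed (use f g f' g' in measurable)
  then show ?thesis
    by (simp add: L2_inner_def f'_def g'_def)
qed

definition L2_closure :: "'a measure \<Rightarrow> ('a \<Rightarrow> real) set set \<Rightarrow> ('a \<Rightarrow> real) set set" where
  "L2_closure M V =
     {L2_class M f | f. f \<in> square_integrable M \<and>
        (\<forall>e>0. \<exists>g\<in>square_integrable M. L2_class M g \<in> V \<and> sqrt (\<integral>x. (f x - g x)\<^sup>2 \<partial>M) < e)}"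

definition L2_span :: "'a measure \<Rightarrow> 'i set \<Rightarrow> ('i \<Rightarrow> 'a \<Rightarrow> real) \<Rightarrow> ('a \<Rightarrow> real) set set" where
  "L2_span M I phi =
     {L2_class M (\<lambda>x. \<Sum>i\<in>F. c i * phi i x) | F c. finite F \<and> F \<subseteq> I}"

text \<open>
  The positive eigenvalues of \<open>T\<close>, repeated according to multiplicity, with orthonormal
  eigenfunctions (given by representatives \<open>phi i\<close>) that span the closure of the range of \<open>T\<close>.
  An index set \<open>I\<close> is used because there may be finitely or infinitely many of them.
\<close>

definition positive_eigensystem ::
  "'a measure \<Rightarrow> (('a \<Rightarrow> real) set \<Rightarrow> ('a \<Rightarrow> real) set) \<Rightarrow> 'i set \<Rightarrow> ('i \<Rightarrow> real) \<Rightarrow>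
   ('i \<Rightarrow> 'a \<Rightarrow> real) \<Rightarrow> bool" where
  "positive_eigensystem M T I lam phi \<longleftrightarrow>
     (\<forall>i\<in>I. 0 < lam i \<and> phi i \<in> square_integrable M \<and>
        T (L2_class M (phi i)) = L2_class M (\<lambda>x. lam i * phi i x)) \<and>
     (\<forall>i\<in>I. \<forall>j\<in>I. L2_inner M (L2_class M (phi i)) (L2_class M (phi j)) = (if i = j then 1 else 0)) \<and>
     L2_closure M (L2_span M I phi) = L2_closure M (T ` L2 M)"


section \<open>The Stein kernel and the kernel Stein discrepancy\<close>

text \<open>
  The library's Bochner integral is restricted to second countable target types. The expectation
  in an arbitrary Hilbert space is therefore taken in the weak (Riesz) sense; it agrees with the
  Bochner integral whenever the latter exists.
\<close>

definition has_mean :: "'x measure \<Rightarrow> ('x \<Rightarrow> 'h::real_inner) \<Rightarrow> 'h \<Rightarrow> bool" where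
  "has_mean M psi m \<longleftrightarrow>
     (\<forall>h. integrable M (\<lambda>x. inner (psi x) h) \<and> (\<integral>x. inner (psi x) h \<partial>M) = inner m h)"

lemma has_bochner_integral_imp_has_mean:
  fixes psi :: "'x \<Rightarrow> 'h::{real_inner, second_countable_topology}"
  assumes "has_bochner_integral M psi m"
  shows "has_mean M psi m"
  unfolding has_mean_def
  using has_bochner_integral_inner_left[OF assms]
  by (metis has_bochner_integral_iff)

definition stein_kernel :: "('x \<Rightarrow> 'h::real_inner) \<Rightarrow> 'x \<Rightarrow> 'x \<Rightarrow> real" where
  "stein_kernel psi x y = inner (psi x) (psi y)"

text \<open>
  The supremum is a genuine one when \<open>psi\<close> is norm-integrable under \<open>P\<close>; \<open>psi\<close> stands for the
  Stein map of the reference measure, which enters only through it.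
\<close>

definition KSD :: "('x \<Rightarrow> 'h::real_inner) \<Rightarrow> 'x measure \<Rightarrow> real" where
  "KSD psi P = (SUP f\<in>{f. norm f \<le> 1}. \<bar>\<integral>x. inner (psi x) f \<partial>P\<bar>)"


section \<open>The inclusion operator, its adjoint and the integral operator\<close>

text \<open>
  The Hilbert space adjoint of \<open>T\<close>, from the space with carrier \<open>V\<close> and inner product \<open>ipV\<close>
  to the space with inner product \<open>ipW\<close>.
\<close>

definition adjoint_on ::
  "'v set \<Rightarrow> ('v \<Rightarrow> 'v \<Rightarrow> real) \<Rightarrow> ('w \<Rightarrow> 'w \<Rightarrow> real) \<Rightarrow> ('v \<Rightarrow> 'w) \<Rightarrow> 'w \<Rightarrow> 'v" where
  "adjoint_on V ipV ipW T w = (THE v. v \<in> V \<and> (\<forall>v'\<in>V. ipW (T v') w = ipV v' v))"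

definition incl_op :: "'x measure \<Rightarrow> ('x \<Rightarrow> real) \<Rightarrow> ('x \<Rightarrow> real) set" where
  "incl_op M f = L2_class M f"

definition incl_adj ::
  "('x \<Rightarrow> real) set \<Rightarrow> (('x \<Rightarrow> real) \<Rightarrow> ('x \<Rightarrow> real) \<Rightarrow> real) \<Rightarrow> 'x measure \<Rightarrow>
   ('x \<Rightarrow> real) set \<Rightarrow> ('x \<Rightarrow> real)" where
  "incl_adj S ip M = adjoint_on S ip (L2_inner M) (incl_op M)"

definition Upsilon ::
  "('x \<Rightarrow> real) set \<Rightarrow> (('x \<Rightarrow> real) \<Rightarrow> ('x \<Rightarrow> real) \<Rightarrow> real) \<Rightarrow> 'x measure \<Rightarrow>
   ('x \<Rightarrow> real) set \<Rightarrow> ('x \<Rightarrow> real) set" where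
  "Upsilon S ip M A = incl_op M (incl_adj S ip M A)"

end

theory Submission
  imports Defs "HOL-Library.Function_Algebras"
begin

text \<open>
  Let \<open>m\<close> be the Riesz representer of the functional \<open>h \<mapsto> \<integral> \<langle>psi x, h\<rangle> u x dP0\<close>. Since \<open>psi\<close> has mean
  zero under \<open>P0\<close>, it is the mean of \<open>psi\<close> under \<open>P\<close>, so the discrepancy is \<open>norm m\<close>. The function
  \<open>J* u\<close> is \<open>x \<mapsto> \<langle>psi x, m\<rangle>\<close>, and the defining property of the adjoint gives
  \<open>\<langle>J* u, J* u\<rangle> = \<integral> (J* u) u dP0 = \<langle>m, m\<rangle>\<close>; no isometry between the RKHS and the Hilbert space of
  \<open>psi\<close> is needed.

  For the series, \<open>w = J J* u\<close> lies in the closed span of the orthonormal \<open>phi i\<close> and has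
  coefficients \<open>\<langle>w, phi i\<rangle> = lam i * \<langle>u, phi i\<rangle>\<close> by symmetry; pairing its orthogonal expansion with \<open>u\<close>
  gives the claim.
\<close>

section \<open>Semi-inner-product spaces: orthonormal expansion and Riesz representation\<close>

text \<open>
  The explicit carrier and scaling let the same results apply to a Hilbert space given as a type,
  to an RKHS given as a set of functions, and to square integrable functions with the merely
  semidefinite form \<open>\<integral> f g\<close>, which avoids passing to classes.
\<close>

locale semi_inner_space = vector_space scale
  for scale :: "real \<Rightarrow> 'b::ab_group_add \<Rightarrow> 'b" (infixr \<open>\<odot>\<close> 75) +
  fixes S :: "'b set" and ip :: "'b \<Rightarrow> 'b \<Rightarrow> real"
  assumes zero_mem: "0 \<in> S"
    and add_mem: "\<lbrakk>f \<in> S; g \<in> S\<rbrakk> \<Longrightarrow> f + g \<in> S"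
    and scale_mem: "f \<in> S \<Longrightarrow> c \<odot> f \<in> S"
    and ip_sym: "\<lbrakk>f \<in> S; g \<in> S\<rbrakk> \<Longrightarrow> ip f g = ip g f"
    and ip_add_left: "\<lbrakk>f \<in> S; g \<in> S; h \<in> S\<rbrakk> \<Longrightarrow> ip (f + g) h = ip f h + ip g h"
    and ip_scale_left: "\<lbrakk>f \<in> S; g \<in> S\<rbrakk> \<Longrightarrow> ip (c \<odot> f) g = c * ip f g"
    and ip_nonneg: "f \<in> S \<Longrightarrow> 0 \<le> ip f f"
begin

lemma diff_mem: "\<lbrakk>f \<in> S; g \<in> S\<rbrakk> \<Longrightarrow> f - g \<in> S"
  using add_mem[of f "(-1) \<odot> g"] scale_mem[of g "-1"] by simp

lemma sum_mem: "(\<And>i. i \<in> F \<Longrightarrow> x i \<in> S) \<Longrightarrow> sum x F \<in> S"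
  by (induction F rule: infinite_finite_induct) (auto simp: zero_mem add_mem)

lemma ip_add_right: "\<lbrakk>f \<in> S; g \<in> S; h \<in> S\<rbrakk> \<Longrightarrow> ip h (f + g) = ip h f + ip h g"
  using ip_sym ip_add_left add_mem by metis

lemma ip_scale_right: "\<lbrakk>f \<in> S; g \<in> S\<rbrakk> \<Longrightarrow> ip g (c \<odot> f) = c * ip g f"
  using ip_sym ip_scale_left scale_mem by metis

lemma ip_diff_left: "\<lbrakk>f \<in> S; g \<in> S; h \<in> S\<rbrakk> \<Longrightarrow> ip (f - g) h = ip f h - ip g h"
  using ip_add_left[of "f - g" g h] diff_mem[of f g] by simp

lemma ip_diff_right: "\<lbrakk>f \<in> S; g \<in> S; h \<in> S\<rbrakk> \<Longrightarrow> ip h (f - g) = ip h f - ip h g"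
  using ip_sym ip_diff_left diff_mem by metis

lemma ip_zero_left: "g \<in> S \<Longrightarrow> ip 0 g = 0"
  using ip_scale_left[of 0 g 0] zero_mem by simp

lemma ip_sum_left:
  assumes "\<And>i. i \<in> F \<Longrightarrow> x i \<in> S" "g \<in> S"
  shows "ip (sum x F) g = (\<Sum>i\<in>F. ip (x i) g)"
  using assms
  by (induction F rule: infinite_finite_induct) (auto simp: ip_zero_left ip_add_left sum_mem)

text \<open>The squared seminorm of \<open>f + t \<odot> g\<close> is a nonnegative polynomial in
  \<open>t\<close>; its value at the minimiser gives the bound. Since \<open>ip\<close> is only
  semidefinite, \<open>ip g g\<close> may vanish for nonzero \<open>g\<close>; the polynomial is
  then affine and its slope must be zero.\<close>

lemma ip_Cauchy_Schwarz:
  assumes "f \<in> S" "g \<in> S"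
  shows "(ip f g)\<^sup>2 \<le> ip f f * ip g g"
proof -
  have *: "0 \<le> ip f f + 2 * t * ip f g + t\<^sup>2 * ip g g" for t
    using ip_nonneg[of "f + t \<odot> g"] assms ip_sym[of g f]
    by (simp add: ip_add_left ip_add_right ip_scale_left ip_scale_right add_mem scale_mem
        algebra_simps power2_eq_square)
  show ?thesis
  proof (cases "ip g g = 0")
    case True
    have "ip f g = 0"
    proof (rule ccontr)
      assume "ip f g \<noteq> 0"
      \<comment> \<open>This \<open>t\<close> gives the affine polynomial the value -1.\<close>
      then show False
        using *[of "- (ip f f + 1) / (2 * ip f g)"] True by (simp add: field_simps)
    qed
    then show ?thesis using True by simp
  next
    case False
    then have "ip g g > 0" using ip_nonneg[OF assms(2)] by simp
    then show ?thesis
      using *[of "- ip f g / ip g g"] by (simp add: field_simps power2_eq_square)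
  qed
qed

text \<open>Once \<open>F\<close> contains the indices of a good approximation, orthogonal
  projection onto the span over \<open>F\<close> is at least as good. The residual is then small,
  and by Cauchy-Schwarz so is its pairing with \<open>u\<close>. Unordered summation treats finite
  and infinite \<open>I\<close> alike.\<close>

lemma has_sum_orthonormal:
  assumes wu: "w \<in> S" "u \<in> S"
    and e: "\<And>i. i \<in> I \<Longrightarrow> e i \<in> S"
    and orth: "\<And>i j. \<lbrakk>i \<in> I; j \<in> I\<rbrakk> \<Longrightarrow> ip (e i) (e j) = (if i = j then 1 else 0)"
    and approx: "\<And>\<epsilon>. \<epsilon> > 0 \<Longrightarrow> \<exists>F c. finite F \<and> F \<subseteq> I \<and>
        ip (w - (\<Sum>i\<in>F. c i \<odot> e i)) (w - (\<Sum>i\<in>F. c i \<odot> e i)) < \<epsilon>"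
  shows "((\<lambda>i. ip w (e i) * ip u (e i)) has_sum ip w u) I"
  unfolding has_sum_def tendsto_iff eventually_finite_subsets_at_top
proof (intro allI impI)
  fix \<epsilon> :: real assume "\<epsilon> > 0"
  \<comment> \<open>The summand 1 avoids division by zero and keeps \<open>\<delta> * ip u u\<close>
    strictly below \<open>\<epsilon>\<^sup>2\<close>.\<close>
  define \<delta> where "\<delta> = \<epsilon>\<^sup>2 / (ip u u + 1)"
  have U: "ip u u \<ge> 0" using ip_nonneg wu by auto
  then have \<delta>: "\<delta> > 0" using \<open>\<epsilon> > 0\<close> by (simp add: \<delta>_def)
  obtain F0 c where F0: "finite F0" "F0 \<subseteq> I"
    and close: "ip (w - (\<Sum>i\<in>F0. c i \<odot> e i)) (w - (\<Sum>i\<in>F0. c i \<odot> e i)) < \<delta>"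
    using approx[OF \<delta>] by blast
  have "dist (\<Sum>i\<in>F. ip w (e i) * ip u (e i)) (ip w u) < \<epsilon>"
    if F: "finite F" "F0 \<subseteq> F" "F \<subseteq> I" for F
  proof -
    define r where "r = w - (\<Sum>i\<in>F. ip w (e i) \<odot> e i)"
    \<comment> \<open>The projection minus the given approximation, whose coefficients are extended
      by zero from \<open>F0\<close> to \<open>F\<close>.\<close>
    define s where "s = (\<Sum>i\<in>F. (ip w (e i) - (if i \<in> F0 then c i else 0)) \<odot> e i)"
    have eF: "e i \<in> S" if "i \<in> F" for i using that F e by auto
    have rS: "r \<in> S"
      unfolding r_def using wu eF by (intro diff_mem sum_mem scale_mem)
    have sS: "s \<in> S" unfolding s_def using eF by (intro sum_mem scale_mem)
    have "ip (e i) r = 0" if "i \<in> F" for i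
    proof -
      have "ip (e i) r = ip r (e i)" using ip_sym rS eF[OF that] by blast
      also have "\<dots> = ip w (e i) - (\<Sum>j\<in>F. ip w (e j) * ip (e j) (e i))"
        unfolding r_def using wu eF that
        by (simp add: ip_diff_left ip_sum_left ip_scale_left sum_mem scale_mem)
      also have "(\<Sum>j\<in>F. ip w (e j) * ip (e j) (e i)) = (\<Sum>j\<in>F. if j = i then ip w (e i) else 0)"
        by (rule sum.cong) (use that F orth in \<open>auto simp: subset_iff\<close>)
      also have "\<dots> = ip w (e i)" using that F by simp
      finally show ?thesis by simp
    qed
    then have sr: "ip s r = 0"
      unfolding s_def using rS eF by (simp add: ip_sum_left ip_scale_left scale_mem)
    have "(\<Sum>i\<in>F. (if i \<in> F0 then c i else 0) \<odot> e i) = (\<Sum>i\<in>F0. c i \<odot> e i)"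
      using F by (intro sum.mono_neutral_cong_right) auto
    then have "w - (\<Sum>i\<in>F0. c i \<odot> e i) = r + s"
      unfolding r_def s_def by (simp add: scale_left_diff_distrib sum_subtractf)
    \<comment> \<open>Pythagoras, as \<open>r\<close> is orthogonal to \<open>s\<close>.\<close>
    then have "ip r r + ip s s < \<delta>"
      using close sr ip_sym[OF rS sS] rS sS by (simp add: ip_add_left ip_add_right add_mem)
    then have r\<delta>: "ip r r < \<delta>" using ip_nonneg[OF sS] by simp
    have "(ip r u)\<^sup>2 \<le> ip r r * ip u u" using ip_Cauchy_Schwarz rS wu by blast
    also have "\<dots> \<le> \<delta> * ip u u" using r\<delta> U by (intro mult_right_mono) auto
    also have "\<dots> < \<epsilon>\<^sup>2" using U \<open>\<epsilon> > 0\<close> by (simp add: \<delta>_def field_simps)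
    finally have "\<bar>ip r u\<bar> < \<epsilon>"
      using \<open>\<epsilon> > 0\<close> power2_less_imp_less[of "\<bar>ip r u\<bar>" \<epsilon>] by simp
    moreover have "ip r u = ip w u - (\<Sum>i\<in>F. ip w (e i) * ip u (e i))"
      unfolding r_def using wu eF
      by (simp add: ip_diff_left ip_sum_left ip_scale_left sum_mem scale_mem ip_sym[of u])
    ultimately show ?thesis by (simp add: dist_real_def abs_minus_commute)
  qed
  then show "\<exists>X. finite X \<and> X \<subseteq> I \<and> (\<forall>Y. finite Y \<and> X \<subseteq> Y \<and> Y \<subseteq> I \<longrightarrow>
      dist (\<Sum>i\<in>Y. ip w (e i) * ip u (e i)) (ip w u) < \<epsilon>)"
    using F0 by blast
qed

end

locale complete_semi_inner_space = semi_inner_space +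
  assumes ip_complete: "\<lbrakk>\<And>n. F n \<in> S; \<And>e. e > 0 \<Longrightarrow>
      \<exists>N. \<forall>m\<ge>N. \<forall>n\<ge>N. ip (F m - F n) (F m - F n) < e\<rbrakk>
    \<Longrightarrow> \<exists>f\<in>S. (\<lambda>n. ip (F n - f) (F n - f)) \<longlonglongrightarrow> 0"
begin

text \<open>The representer minimises \<open>ip f f - 2 * L f\<close>: a minimising sequence is
  Cauchy by the parallelogram law, and the first-order condition at its limit is the
  representation.\<close>

lemma Riesz_representation:
  fixes L :: "'a \<Rightarrow> real"
  assumes L_add: "\<And>f g. \<lbrakk>f \<in> S; g \<in> S\<rbrakk> \<Longrightarrow> L (f + g) = L f + L g"
    and L_scale: "\<And>c f. f \<in> S \<Longrightarrow> L (c \<odot> f) = c * L f"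
    and L_bound: "\<And>f. f \<in> S \<Longrightarrow> (L f)\<^sup>2 \<le> C * ip f f"
  shows "\<exists>v\<in>S. \<forall>f\<in>S. L f = ip f v"
proof -
  define J where "J f = ip f f - 2 * L f" for f
  define d where "d = Inf (J ` S)"
  \<comment> \<open>From \<open>2 * sqrt (\<bar>C\<bar> * ip f f) \<le> \<bar>C\<bar> + ip f
    f\<close>. The absolute value enters because the sign of \<open>C\<close> is not fixed.\<close>
  have J_lower: "J f \<ge> - \<bar>C\<bar>" if "f \<in> S" for f
  proof -
    have "(L f)\<^sup>2 \<le> \<bar>C\<bar> * ip f f"
      using L_bound[OF that] ip_nonneg[OF that] mult_right_mono[of C "\<bar>C\<bar>" "ip f f"] by linarith
    moreover have "4 * (\<bar>C\<bar> * ip f f) \<le> (\<bar>C\<bar> + ip f f)\<^sup>2"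
      using zero_le_power2[of "\<bar>C\<bar> - ip f f"] by (simp add: power2_eq_square algebra_simps)
    ultimately have "(2 * L f)\<^sup>2 \<le> (\<bar>C\<bar> + ip f f)\<^sup>2" by simp
    then have "2 * L f \<le> \<bar>C\<bar> + ip f f"
      by (rule power2_le_imp_le) (use ip_nonneg[OF that] in simp)
    then show ?thesis by (simp add: J_def)
  qed
  then have bdd: "bdd_below (J ` S)" by (auto simp: bdd_below_def)
  then have d_le: "d \<le> J f" if "f \<in> S" for f
    unfolding d_def using that by (auto intro: cInf_lower)
  have "\<exists>f\<in>S. J f < d + 1 / real (Suc n)" for n
  proof -
    have "Inf (J ` S) < d + 1 / real (Suc n)" by (simp add: d_def)
    then show ?thesis using zero_mem by (subst (asm) cInf_less_iff) (use bdd in auto)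
  qed
  then obtain F where FS: "\<And>n. F n \<in> S" and FJ: "\<And>n. J (F n) < d + 1 / real (Suc n)"
    by metis
  have pert: "d \<le> J f + 2 * t * (ip f g - L g) + t\<^sup>2 * ip g g" if "f \<in> S" "g \<in> S" for f g t
    using d_le[of "f + t \<odot> g"] that ip_sym[of g f]
    by (simp add: J_def ip_add_left ip_add_right ip_scale_left ip_scale_right add_mem scale_mem
        L_add L_scale algebra_simps power2_eq_square)
  \<comment> \<open>The left side equals \<open>2 * J f + 2 * J g\<close> minus four times
    \<open>J\<close> at the midpoint, which is at least \<open>d\<close>.\<close>
  have parallelogram: "ip (f - g) (f - g) \<le> 2 * (J f - d) + 2 * (J g - d)"
    if "f \<in> S" "g \<in> S" for f g
    using d_le[of "(1/2) \<odot> (f + g)"] that ip_sym[of g f]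
    by (simp add: J_def ip_diff_left ip_diff_right diff_mem ip_add_left ip_add_right ip_scale_left
        ip_scale_right add_mem scale_mem L_add L_scale algebra_simps)
  have "\<exists>v\<in>S. (\<lambda>n. ip (F n - v) (F n - v)) \<longlonglongrightarrow> 0"
  proof (rule ip_complete[OF FS])
    fix e :: real assume "e > 0"
    \<comment> \<open>Each of the two excesses over \<open>d\<close> is below e/4 and enters the
      parallelogram bound with factor 2.\<close>
    then obtain N where N: "1 / real (Suc N) < e / 4"
      using nat_approx_posE[of "e/4"] by auto
    have "ip (F m - F n) (F m - F n) < e" if "m \<ge> N" "n \<ge> N" for m n
    proof -
      have "1 / real (Suc k) \<le> 1 / real (Suc N)" if "k \<ge> N" for k
        using that by (simp add: frac_le)
      from this[OF that(1)] this[OF that(2)] show ?thesis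
        using N parallelogram[OF FS[of m] FS[of n]] FJ[of m] FJ[of n] by argo
    qed
    then show "\<exists>N. \<forall>m\<ge>N. \<forall>n\<ge>N. ip (F m - F n) (F m - F n) < e" by blast
  qed
  then obtain v where vS: "v \<in> S" and lim: "(\<lambda>n. ip (F n - v) (F n - v)) \<longlonglongrightarrow> 0" by blast
  have "L f = ip f v" if fS: "f \<in> S" for f
  proof -
    have "(\<lambda>n. ip (F n - v) f) \<longlonglongrightarrow> 0"
    proof (rule Lim_null_comparison)
      show "(\<lambda>n. sqrt (ip (F n - v) (F n - v) * ip f f)) \<longlonglongrightarrow> 0"
        using tendsto_real_sqrt[OF tendsto_mult_right[OF lim, of "ip f f"]] by simp
      show "\<forall>\<^sub>F n in sequentially. norm (ip (F n - v) f) \<le> sqrt (ip (F n - v) (F n - v) * ip f f)"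
        using ip_Cauchy_Schwarz[OF diff_mem[OF FS vS] fS] by (auto intro!: always_eventually real_le_rsqrt)
    qed
    then have lim_ip: "(\<lambda>n. ip (F n) f) \<longlonglongrightarrow> ip v f"
      using fS vS FS by (simp add: ip_diff_left LIM_zero_iff)
    \<comment> \<open>The limit of \<open>pert\<close> along \<open>F n\<close>: near-minimality
      cancels \<open>d\<close> up to \<open>1 / real (Suc n)\<close>, so \<open>v\<close> satisfies
      the inequality of a minimiser.\<close>
    have ge: "0 \<le> 2 * t * (ip v f - L f) + t\<^sup>2 * ip f f" for t
    proof (rule LIMSEQ_le_const)
      have "(\<lambda>n. 1 / real (Suc n) + 2 * t * (ip (F n) f - L f) + t\<^sup>2 * ip f f)
          \<longlonglongrightarrow> 0 + 2 * t * (ip v f - L f) + t\<^sup>2 * ip f f"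
        using LIMSEQ_inverse_real_of_nat lim_ip
        by (intro tendsto_intros) (auto simp: inverse_eq_divide)
      then show "(\<lambda>n. 1 / real (Suc n) + 2 * t * (ip (F n) f - L f) + t\<^sup>2 * ip f f)
          \<longlonglongrightarrow> 2 * t * (ip v f - L f) + t\<^sup>2 * ip f f" by simp
      show "\<exists>N. \<forall>n\<ge>N. 0 \<le> 1 / real (Suc n) + 2 * t * (ip (F n) f - L f) + t\<^sup>2 * ip f f"
        using pert[OF FS fS, of _ t] FJ by (smt (verit))
    qed
    define b where "b = ip v f - L f"
    \<comment> \<open>The summand 1 allows division when \<open>f\<close> has seminorm zero;
      \<open>t = - b / a\<close> then makes the bound \<open>- (b\<^sup>2 / a)\<close>.\<close>
    define a where "a = ip f f + 1"
    have a: "a > 0" "ip f f \<le> a" using ip_nonneg[OF fS] by (auto simp: a_def)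
    have "0 \<le> 2 * (- b / a) * b + (- b / a)\<^sup>2 * ip f f" using ge unfolding b_def by blast
    also have "\<dots> \<le> 2 * (- b / a) * b + (- b / a)\<^sup>2 * a"
      using a by (intro add_left_mono mult_left_mono) auto
    also have "\<dots> = - (b\<^sup>2 / a)" using a by (simp add: field_simps power2_eq_square)
    finally have "b = 0" using a by (simp add: divide_le_0_iff)
    then show ?thesis using ip_sym[OF fS vS] by (simp add: b_def)
  qed
  then show ?thesis using vS by blast
qed

end

section \<open>Instances: square integrable functions, function spaces and Hilbert space
  types\<close>

lemma sum_fun_eq: "(\<Sum>i\<in>F. g i) = (\<lambda>x. \<Sum>i\<in>F. g i x)" for g :: "'i \<Rightarrow> 'a \<Rightarrow> 'b::comm_monoid_add"
  by (induction F rule: infinite_finite_induct) (auto simp: fun_eq_iff)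

lemma vector_space_fun: "vector_space (\<lambda>c (f :: 'a \<Rightarrow> real) x. c * f x)"
  by standard (auto simp: fun_eq_iff algebra_simps)

lemma square_integrable_mult:
  assumes "f \<in> square_integrable M" "g \<in> square_integrable M"
  shows "integrable M (\<lambda>x. f x * g x)"
proof (rule Bochner_Integration.integrable_bound)
  have [measurable]: "f \<in> borel_measurable M" "g \<in> borel_measurable M"
    using assms by (auto simp: square_integrable_def)
  show "(\<lambda>x. f x * g x) \<in> borel_measurable M" by measurable
  show "integrable M (\<lambda>x. (f x)\<^sup>2 + (g x)\<^sup>2)"
    using assms by (auto simp: square_integrable_def)
  have "\<bar>f x * g x\<bar> \<le> (f x)\<^sup>2 + (g x)\<^sup>2" for x
  proof -
    have "2 * (\<bar>f x\<bar> * \<bar>g x\<bar>) \<le> (f x)\<^sup>2 + (g x)\<^sup>2"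
      using sum_squares_bound[of "\<bar>f x\<bar>" "\<bar>g x\<bar>"] by simp
    moreover have "0 \<le> \<bar>f x\<bar> * \<bar>g x\<bar>" by simp
    ultimately show ?thesis unfolding abs_mult by linarith
  qed
  then show "AE x in M. norm (f x * g x) \<le> norm ((f x)\<^sup>2 + (g x)\<^sup>2)" by simp
qed

lemma semi_inner_space_square_integrable:
  "semi_inner_space (\<lambda>c f x. c * f x) (square_integrable M) (\<lambda>f g. \<integral>x. f x * g x \<partial>M)"
proof -
  interpret vector_space "\<lambda>c (f :: 'a \<Rightarrow> real) x. c * f x" by (rule vector_space_fun)
  show ?thesis
  proof
    show "0 \<in> square_integrable M" by (simp add: square_integrable_def zero_fun_def)
  next
    fix f g assume fg: "f \<in> square_integrable M" "g \<in> square_integrable M"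
    have "integrable M (\<lambda>x. (f x)\<^sup>2 + 2 * (f x * g x) + (g x)\<^sup>2)"
      using fg square_integrable_mult[OF fg] by (auto simp: square_integrable_def)
    moreover have "(\<lambda>x. (f x + g x)\<^sup>2) = (\<lambda>x. (f x)\<^sup>2 + 2 * (f x * g x) + (g x)\<^sup>2)"
      by (simp add: power2_sum mult.assoc algebra_simps)
    ultimately show "f + g \<in> square_integrable M"
      using fg by (auto simp: square_integrable_def plus_fun_def)
    show "(\<integral>x. f x * g x \<partial>M) = (\<integral>x. g x * f x \<partial>M)" by (simp add: mult.commute)
    show "(\<integral>x. (f + g) x * h x \<partial>M) = (\<integral>x. f x * h x \<partial>M) + (\<integral>x. g x * h x \<partial>M)"
      if "h \<in> square_integrable M" for h
      using fg that by (simp add: distrib_right square_integrable_mult)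
  qed (auto simp: square_integrable_def power_mult_distrib mult.assoc)
qed

lemma L2_class_eq_iff:
  assumes "f \<in> borel_measurable M" "g \<in> borel_measurable M"
  shows "L2_class M f = L2_class M g \<longleftrightarrow> (AE x in M. f x = g x)"
proof
  assume "L2_class M f = L2_class M g"
  moreover have "f \<in> L2_class M f" using assms by (simp add: L2_class_def)
  ultimately show "AE x in M. f x = g x" by (simp add: L2_class_def)
next
  assume "AE x in M. f x = g x"
  then have "(AE x in M. h x = f x) \<longleftrightarrow> (AE x in M. h x = g x)" for h
    by (auto elim: AE_mp)
  then show "L2_class M f = L2_class M g" by (simp add: L2_class_def)
qed

lemma complete_semi_inner_space_hilbert_function_space:
  assumes "is_hilbert_function_space S ip"
  shows "complete_semi_inner_space (\<lambda>c f x. c * f x) S ip"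
proof -
  interpret vector_space "\<lambda>c (f :: 'a \<Rightarrow> real) x. c * f x" by (rule vector_space_fun)
  note H = assms[unfolded is_hilbert_function_space_def]
  interpret semi_inner_space "\<lambda>c (f :: 'a \<Rightarrow> real) x. c * f x" S ip
    unfolding semi_inner_space_def semi_inner_space_axioms_def zero_fun_def plus_fun_def
    using vector_space_axioms H by (intro conjI allI impI) blast+
  show ?thesis
  proof
    fix F :: "nat \<Rightarrow> 'a \<Rightarrow> real"
    assume FS: "\<And>n. F n \<in> S"
      and cauchy: "\<And>e. e > 0 \<Longrightarrow> \<exists>N. \<forall>m\<ge>N. \<forall>n\<ge>N. ip (F m - F n) (F m - F n) < e"
    have "\<forall>e>0. \<exists>N. \<forall>m\<ge>N. \<forall>n\<ge>N. sqrt (ip (F m - F n) (F m - F n)) < e"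
    proof (intro allI impI)
      fix e :: real assume "e > 0"
      then obtain N where "\<forall>m\<ge>N. \<forall>n\<ge>N. ip (F m - F n) (F m - F n) < e\<^sup>2"
        using cauchy[of "e\<^sup>2"] by auto
      with \<open>e > 0\<close> show "\<exists>N. \<forall>m\<ge>N. \<forall>n\<ge>N. sqrt (ip (F m - F n) (F m - F n)) < e"
        by (intro exI[of _ N] allI impI real_less_lsqrt) auto
    qed
    then obtain f where fS: "f \<in> S" and lim: "(\<lambda>n. sqrt (ip (F n - f) (F n - f))) \<longlonglongrightarrow> 0"
      using H FS unfolding fun_diff_def by blast
    have "(\<lambda>n. ip (F n - f) (F n - f)) \<longlonglongrightarrow> 0"
      using tendsto_power[OF lim, of 2] ip_nonneg[OF diff_mem[OF FS fS]] by simp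
    with fS show "\<exists>f\<in>S. (\<lambda>n. ip (F n - f) (F n - f)) \<longlonglongrightarrow> 0" by blast
  qed
qed

lemma complete_semi_inner_space_UNIV:
  "complete_semi_inner_space scaleR UNIV (inner :: 'h::{real_inner, complete_space} \<Rightarrow> _)"
proof -
  interpret vector_space "scaleR :: real \<Rightarrow> 'h \<Rightarrow> 'h" by (rule real_vector.vector_space_axioms)
  interpret semi_inner_space "scaleR :: real \<Rightarrow> 'h \<Rightarrow> 'h" UNIV inner
    by unfold_locales (simp_all add: inner_add_left, rule inner_commute)
  show ?thesis
  proof
    fix F :: "nat \<Rightarrow> 'h"
    assume cauchy: "\<And>e. e > 0 \<Longrightarrow> \<exists>N. \<forall>m\<ge>N. \<forall>n\<ge>N. inner (F m - F n) (F m - F n) < e"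
    have "Cauchy F"
      unfolding Cauchy_def dist_norm
    proof (intro allI impI)
      fix e :: real assume "e > 0"
      then show "\<exists>N. \<forall>m\<ge>N. \<forall>n\<ge>N. norm (F m - F n) < e"
        using cauchy[of "e\<^sup>2"] power2_less_imp_less[of _ e]
        by (simp flip: power2_norm_eq_inner) blast
    qed
    then obtain f where "F \<longlonglongrightarrow> f" using Cauchy_convergent convergent_def by blast
    then have "(\<lambda>n. norm (F n - f)) \<longlonglongrightarrow> 0" by (simp add: LIM_zero tendsto_norm_zero)
    from tendsto_power[OF this, of 2]
    show "\<exists>f\<in>UNIV. (\<lambda>n. inner (F n - f) (F n - f)) \<longlonglongrightarrow> 0"
      by (auto simp: power2_norm_eq_inner)
  qed
qed

section \<open>The inclusion of an RKHS into L2, its adjoint and the integral operator\<close>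

locale L2_rkhs =
  fixes M :: "'a measure" and K :: "'a \<Rightarrow> 'a \<Rightarrow> real" and S ip and C :: real
  assumes rkhs: "is_rkhs K S ip"
    and S_L2: "S \<subseteq> square_integrable M"
    and incl_bounded: "f \<in> S \<Longrightarrow> (\<integral>x. (f x)\<^sup>2 \<partial>M) \<le> C * ip f f"
begin

sublocale H: complete_semi_inner_space "\<lambda>c f x. c * f x" S ip
  using rkhs by (intro complete_semi_inner_space_hilbert_function_space) (simp add: is_rkhs_def)

sublocale L2: semi_inner_space "\<lambda>c f x. c * f x" "square_integrable M" "\<lambda>f g. \<integral>x. f x * g x \<partial>M"
  by (rule semi_inner_space_square_integrable)

abbreviation Jadj :: "('a \<Rightarrow> real) \<Rightarrow> 'a \<Rightarrow> real" where
  "Jadj w \<equiv> incl_adj S ip M (L2_class M w)"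

lemma measurable_L2: "f \<in> square_integrable M \<Longrightarrow> f \<in> borel_measurable M"
  by (simp add: square_integrable_def)

lemma S_measurable: "f \<in> S \<Longrightarrow> f \<in> borel_measurable M"
  using S_L2 measurable_L2 by blast

text \<open>The adjoint is a definite description, so existence and uniqueness are both at stake.
  Riesz in the RKHS gives existence, since Cauchy-Schwarz in L2 and the bounded inclusion control
  the functional; definiteness of \<open>ip\<close> on \<open>S\<close> gives uniqueness.\<close>

lemma incl_adj_ex1:
  assumes w: "w \<in> square_integrable M"
  shows "\<exists>!v. v \<in> S \<and> (\<forall>f\<in>S. (\<integral>x. f x * w x \<partial>M) = ip f v)"
proof -
  obtain v where v: "v \<in> S" "\<forall>f\<in>S. (\<integral>x. f x * w x \<partial>M) = ip f v"
  proof -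
    have "\<exists>v\<in>S. \<forall>f\<in>S. (\<integral>x. f x * w x \<partial>M) = ip f v"
    proof (rule H.Riesz_representation)
      fix f assume f: "f \<in> S"
      have "(\<integral>x. f x * w x \<partial>M)\<^sup>2 \<le> (\<integral>x. f x * f x \<partial>M) * (\<integral>x. w x * w x \<partial>M)"
        using L2.ip_Cauchy_Schwarz f w S_L2 by blast
      also have "\<dots> \<le> (C * ip f f) * (\<integral>x. w x * w x \<partial>M)"
        using incl_bounded[OF f] L2.ip_nonneg[OF w]
        by (intro mult_right_mono) (auto simp: power2_eq_square)
      finally show "(\<integral>x. f x * w x \<partial>M)\<^sup>2 \<le> (C * (\<integral>x. w x * w x \<partial>M)) * ip f f"
        by (simp add: mult_ac)
    qed (use L2.ip_add_left L2.ip_scale_left w S_L2 in blast)+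
    then show thesis using that by blast
  qed
  have unique: "v' = v" if "v' \<in> S" "\<forall>f\<in>S. ip f v' = ip f v" for v'
  proof -
    have "ip (v' - v) (v' - v) = 0"
      using that v(1) H.diff_mem by (simp add: H.ip_diff_right)
    then have "v' - v = (\<lambda>x. 0)"
      using rkhs H.diff_mem that v(1) by (auto simp: is_rkhs_def is_hilbert_function_space_def)
    then show ?thesis by (simp add: fun_eq_iff)
  qed
  show ?thesis
  proof (rule ex1I)
    show "v \<in> S \<and> (\<forall>f\<in>S. (\<integral>x. f x * w x \<partial>M) = ip f v)" using v by blast
  qed (use v(2) unique in auto)
qed

text \<open>Replaces classes by representatives inside the description, so that
  \<open>incl_adj_ex1\<close> applies to it.\<close>

lemma incl_adj_eq_The:
  assumes w: "w \<in> square_integrable M"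
  shows "Jadj w = (THE v. v \<in> S \<and> (\<forall>f\<in>S. (\<integral>x. f x * w x \<partial>M) = ip f v))"
proof -
  have "L2_inner M (L2_class M f) (L2_class M w) = (\<integral>x. f x * w x \<partial>M)" if "f \<in> S" for f
    using that w by (intro L2_inner_class S_measurable measurable_L2)
  then show ?thesis
    unfolding incl_adj_def adjoint_on_def incl_op_def
    by (intro arg_cong[where f = The] ext) auto
qed

lemma
  assumes w: "w \<in> square_integrable M"
  shows incl_adj_mem: "Jadj w \<in> S"
    and incl_adj_inner: "f \<in> S \<Longrightarrow> ip f (Jadj w) = (\<integral>x. f x * w x \<partial>M)"
  using theI'[OF incl_adj_ex1[OF w], folded incl_adj_eq_The[OF w]] by auto

text \<open>The reproducing property evaluates \<open>Jadj w\<close> by pairing it with a kernel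
  section, and the adjoint moves that pairing to L2. This recovers the usual integral formula for
  the adjoint.\<close>

lemma incl_adj_apply:
  assumes w: "w \<in> square_integrable M"
  shows "Jadj w x = (\<integral>y. K y x * w y \<partial>M)"
proof -
  have Kx: "(\<lambda>y. K y x) \<in> S" using rkhs by (simp add: is_rkhs_def)
  have "Jadj w x = ip (Jadj w) (\<lambda>y. K y x)"
    using rkhs incl_adj_mem[OF w] by (simp add: is_rkhs_def)
  also have "\<dots> = ip (\<lambda>y. K y x) (Jadj w)" using H.ip_sym Kx incl_adj_mem[OF w] by blast
  also have "\<dots> = (\<integral>y. K y x * w y \<partial>M)" by (rule incl_adj_inner[OF w Kx])
  finally show ?thesis .
qed

lemma Upsilon_inner:
  assumes w: "w \<in> square_integrable M"  and g: "g \<in> square_integrable M"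
  shows "L2_inner M (Upsilon S ip M (L2_class M w)) (L2_class M g) = ip (Jadj w) (Jadj g)"
  unfolding Upsilon_def incl_op_def
  using incl_adj_mem[OF w] g
  by (simp add: L2_inner_class S_measurable measurable_L2 incl_adj_inner)

lemma Upsilon_quadratic_form_has_sum:
  assumes u: "u \<in> square_integrable M"
    and eig: "positive_eigensystem M (Upsilon S ip M) I lam phi"
  shows "((\<lambda>i. lam i * (L2_inner M (L2_class M u) (L2_class M (phi i)))\<^sup>2)
    has_sum L2_inner M (Upsilon S ip M (L2_class M u)) (L2_class M u)) I"
proof -
  have phi: "phi i \<in> square_integrable M" if "i \<in> I" for i
    using eig that by (simp add: positive_eigensystem_def)
  have w: "Jadj u \<in> square_integrable M" using incl_adj_mem[OF u] S_L2 by blast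
  \<comment> \<open>\<open>ip (Jadj u) (Jadj (phi i))\<close> can be read as an L2 pairing from
    either side; reading it from the other side puts the operator on the eigenfunction.\<close>
  have coeff: "(\<integral>x. Jadj u x * phi i x \<partial>M) = lam i * (\<integral>x. u x * phi i x \<partial>M)" if i: "i \<in> I" for i
  proof -
    have [measurable]: "phi i \<in> borel_measurable M" "u \<in> borel_measurable M"
      "Jadj (phi i) \<in> borel_measurable M"
      using phi[OF i] u incl_adj_mem[OF phi[OF i]] by (auto intro: measurable_L2 S_measurable)
    have "L2_class M (Jadj (phi i)) = L2_class M (\<lambda>x. lam i * phi i x)"
      using eig i by (simp add: positive_eigensystem_def Upsilon_def incl_op_def)
    then have ae: "AE x in M. Jadj (phi i) x = lam i * phi i x"
      by (subst (asm) L2_class_eq_iff) auto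
    have "(\<integral>x. Jadj u x * phi i x \<partial>M) = ip (Jadj u) (Jadj (phi i))"
      using incl_adj_inner[OF phi[OF i] incl_adj_mem[OF u]] by simp
    also have "\<dots> = ip (Jadj (phi i)) (Jadj u)"
      using H.ip_sym incl_adj_mem[OF u] incl_adj_mem[OF phi[OF i]] by blast
    also have "\<dots> = (\<integral>x. Jadj (phi i) x * u x \<partial>M)"
      by (rule incl_adj_inner[OF u incl_adj_mem[OF phi[OF i]]])
    also have "\<dots> = (\<integral>x. lam i * (u x * phi i x) \<partial>M)"
      by (rule integral_cong_AE) (measurable, use ae in eventually_elim, simp)
    finally show ?thesis by simp
  qed
  have "((\<lambda>i. (\<integral>x. Jadj u x * phi i x \<partial>M) * (\<integral>x. u x * phi i x \<partial>M))
      has_sum (\<integral>x. Jadj u x * u x \<partial>M)) I"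
  proof (rule L2.has_sum_orthonormal[OF w u phi])
    show "(\<integral>x. phi i x * phi j x \<partial>M) = (if i = j then 1 else 0)" if "i \<in> I" "j \<in> I" for i j
      using eig that phi
      by (simp add: positive_eigensystem_def measurable_L2 flip: L2_inner_class)
  next
    fix \<epsilon> :: real assume "\<epsilon> > 0"
    \<comment> \<open>The class is \<open>Upsilon\<close> applied to the class of \<open>u\<close>,
      so it approximates itself; the spanning condition then moves it to the closed span of the
      eigenfunctions.\<close>
    have "L2_class M (Jadj u) \<in> L2_closure M (Upsilon S ip M ` L2 M)"
      unfolding L2_closure_def
    proof (intro CollectI exI conjI allI impI)
      show "\<exists>g\<in>square_integrable M. L2_class M g \<in> Upsilon S ip M ` L2 M \<and>
          sqrt (\<integral>x. (Jadj u x - g x)\<^sup>2 \<partial>M) < e" if "e > 0" for e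
        using w u that
        by (intro bexI[of _ "Jadj u"]) (auto simp: Upsilon_def incl_op_def L2_def)
    qed (use w in auto)
    then have "L2_class M (Jadj u) \<in> L2_closure M (L2_span M I phi)"
      using eig by (simp add: positive_eigensystem_def)
    then obtain f where f: "f \<in> square_integrable M" "L2_class M (Jadj u) = L2_class M f"
      and "\<forall>e>0. \<exists>g\<in>square_integrable M. L2_class M g \<in> L2_span M I phi \<and>
        sqrt (\<integral>x. (f x - g x)\<^sup>2 \<partial>M) < e"
      unfolding L2_closure_def by blast
    \<comment> \<open>The closure is stated with the norm, \<open>approx\<close> with its square,
      hence the root of \<open>\<epsilon>\<close>.\<close>
    then obtain g where g: "g \<in> square_integrable M" "L2_class M g \<in> L2_span M I phi"
      and fg: "sqrt (\<integral>x. (f x - g x)\<^sup>2 \<partial>M) < sqrt \<epsilon>"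
      using \<open>\<epsilon> > 0\<close> by (meson real_sqrt_gt_zero)
    from g(2) obtain F c where F: "finite F" "F \<subseteq> I"
      and gF: "L2_class M g = L2_class M (\<lambda>x. \<Sum>i\<in>F. c i * phi i x)"
      unfolding L2_span_def by blast
    have [measurable]: "f \<in> borel_measurable M" "g \<in> borel_measurable M" "Jadj u \<in> borel_measurable M"
      "\<And>i. i \<in> F \<Longrightarrow> phi i \<in> borel_measurable M"
      using f g w phi F(2) by (auto intro: measurable_L2)
    have ae: "AE x in M. Jadj u x = f x" "AE x in M. g x = (\<Sum>i\<in>F. c i * phi i x)"
      using f(2) gF by (subst (asm) L2_class_eq_iff; measurable)+
    let ?d = "Jadj u - (\<Sum>i\<in>F. (\<lambda>x. c i * phi i x))"
    have "(\<integral>x. ?d x * ?d x \<partial>M) = (\<integral>x. (f x - g x)\<^sup>2 \<partial>M)"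
      unfolding sum_fun_eq fun_diff_def
      by (rule integral_cong_AE) (measurable, use ae in eventually_elim, simp add: power2_eq_square)
    then have "(\<integral>x. ?d x * ?d x \<partial>M) < \<epsilon>" using fg by simp
    then show "\<exists>F c. finite F \<and> F \<subseteq> I \<and>
        (\<integral>x. (Jadj u - (\<Sum>i\<in>F. (\<lambda>x. c i * phi i x))) x *
              (Jadj u - (\<Sum>i\<in>F. (\<lambda>x. c i * phi i x))) x \<partial>M) < \<epsilon>"
      using F by blast
  qed
  moreover have "(\<integral>x. Jadj u x * u x \<partial>M) = L2_inner M (Upsilon S ip M (L2_class M u)) (L2_class M u)"
    using u w by (simp add: Upsilon_def incl_op_def L2_inner_class measurable_L2)
  moreover have "((\<lambda>i. (\<integral>x. Jadj u x * phi i x \<partial>M) * (\<integral>x. u x * phi i x \<partial>M)) has_sum s) I \<longleftrightarrow>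
      ((\<lambda>i. lam i * (L2_inner M (L2_class M u) (L2_class M (phi i)))\<^sup>2) has_sum s) I" for s
    using coeff phi u
    by (intro has_sum_cong) (simp add: L2_inner_class measurable_L2 power2_eq_square)
  ultimately show ?thesis by simp
qed

end

section \<open>Regularity of the Stein map and of the functions in its RKHS\<close>

text \<open>The squared distance of \<open>psi x\<close> and \<open>psi a\<close> expands into
  kernel values that depend continuously on \<open>x\<close> and cancel at
  \<open>x = a\<close>.\<close>

lemma continuous_feature_map:
  assumes "continuous_on UNIV (\<lambda>(x, y). stein_kernel psi x y)"
  shows "continuous_on UNIV psi"
proof -
  have "(psi \<longlongrightarrow> psi a) (at a)" for a
  proof -
    let ?k = "stein_kernel psi"
    have K: "continuous_on UNIV (\<lambda>x. (\<lambda>(x, y). ?k x y) (g x))" if "continuous_on UNIV g" for g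
      using continuous_on_compose2[OF assms that] by auto
    have "continuous_on UNIV (\<lambda>x. ?k x x)" "continuous_on UNIV (\<lambda>x. ?k x a)"
      using K[of "\<lambda>x. (x, x)"] K[of "\<lambda>x. (x, a)"] by (simp_all add: continuous_on_Pair)
    then have "continuous_on UNIV (\<lambda>x. sqrt (?k x x - 2 * ?k x a + ?k a a))"
      by (intro continuous_intros)
    moreover have "(\<lambda>x. sqrt (?k x x - 2 * ?k x a + ?k a a)) = (\<lambda>x. dist (psi x) (psi a))"
      by (simp add: dist_norm norm_eq_sqrt_inner stein_kernel_def inner_diff_left inner_diff_right
          inner_commute algebra_simps)
    ultimately have "continuous_on UNIV (\<lambda>x. dist (psi x) (psi a))" by (simp only:)
    then have "((\<lambda>x. dist (psi x) (psi a)) \<longlongrightarrow> dist (psi a) (psi a)) (at a)"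
      by (simp only: continuous_on_def) blast
    then have "((\<lambda>x. dist (psi x) (psi a)) \<longlongrightarrow> 0) (at a)" by simp
    then show ?thesis by (rule tendsto_dist_iff[THEN iffD2])
  qed
  then show ?thesis by (simp add: continuous_on_def)
qed

text \<open>Cauchy-Schwarz against a kernel section, and against a difference of two sections, whose
  RKHS norm is the distance of the features.\<close>

lemma rkhs_stein_kernel_bounds:
  assumes "is_rkhs (stein_kernel psi) S ip" and f: "f \<in> S"
  shows "(f x)\<^sup>2 \<le> ip f f * stein_kernel psi x x"
    and "(f x - f y)\<^sup>2 \<le> ip f f * (dist (psi x) (psi y))\<^sup>2"
proof -
  interpret complete_semi_inner_space "\<lambda>c f x. c * f x" S ip
    using assms(1)
    by (intro complete_semi_inner_space_hilbert_function_space) (simp add: is_rkhs_def)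
  define k where "k x = (\<lambda>y. stein_kernel psi y x)" for x
  have kS: "k x \<in> S" and rep: "g \<in> S \<Longrightarrow> ip g (k x) = g x" for x g
    using assms(1) by (auto simp: is_rkhs_def k_def)
  have kk: "ip (k x) (k y) = inner (psi x) (psi y)" for x y
    using rep[OF kS[of x], of y] by (simp add: k_def stein_kernel_def inner_commute)
  show "(f x)\<^sup>2 \<le> ip f f * stein_kernel psi x x"
    using ip_Cauchy_Schwarz[OF f kS[of x]] by (simp add: rep[OF f] kk stein_kernel_def)
  have "(dist (psi x) (psi y))\<^sup>2 = ip (k x - k y) (k x - k y)"
    by (simp add: dist_norm power2_norm_eq_inner ip_diff_left ip_diff_right diff_mem kS kk
        inner_diff_left inner_diff_right)
  then show "(f x - f y)\<^sup>2 \<le> ip f f * (dist (psi x) (psi y))\<^sup>2"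
    using ip_Cauchy_Schwarz[OF f diff_mem[OF kS[of x] kS[of y]]]
    by (simp add: ip_diff_right f kS rep[OF f])
qed

text \<open>By the second bound \<open>f\<close> is Lipschitz with respect to the distance of
  features, so it inherits the continuity of \<open>psi\<close>. This is the source of Borel
  measurability on \<open>S\<close>.\<close>

lemma rkhs_stein_kernel_continuous:
  assumes S: "is_rkhs (stein_kernel psi) S ip" and f: "f \<in> S" and psi: "continuous_on UNIV psi"
  shows "continuous_on UNIV f"
proof -
  have "(f \<longlongrightarrow> f a) (at a)" for a
  proof (subst tendsto_dist_iff, rule Lim_null_comparison)
    have "(psi \<longlongrightarrow> psi a) (at a)" using psi by (auto simp: continuous_on_def)
    then have "((\<lambda>x. dist (psi x) (psi a)) \<longlongrightarrow> 0) (at a)" by (rule tendsto_dist_iff[THEN iffD1])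
    from tendsto_mult_right_zero[OF this, of "sqrt (ip f f)"]
    show "((\<lambda>x. sqrt (ip f f) * dist (psi x) (psi a)) \<longlongrightarrow> 0) (at a)" .
    have "dist (f x) (f a) \<le> sqrt (ip f f) * dist (psi x) (psi a)" for x
      using real_sqrt_le_mono[OF rkhs_stein_kernel_bounds(2)[OF S f, of x a]]
      by (simp add: real_sqrt_mult dist_real_def)
    then show "\<forall>\<^sub>F x in at a. norm (dist (f x) (f a)) \<le> sqrt (ip f f) * dist (psi x) (psi a)"
      by simp
  qed
  then show ?thesis by (simp add: continuous_on_def)
qed

text \<open>Integrating the first pointwise bound shows that the integral of the kernel diagonal
  bounds the squared norm of the inclusion.\<close>

lemma L2_rkhs_stein_kernel:
  fixes psi :: "'x::topological_space \<Rightarrow> 'h::real_inner"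
  assumes S: "is_rkhs (stein_kernel psi) S ip" and psi: "continuous_on UNIV psi"
    and M: "sets M = sets borel" and int: "integrable M (\<lambda>x. stein_kernel psi x x)"
  shows "L2_rkhs M (stein_kernel psi) S ip (\<integral>x. stein_kernel psi x x \<partial>M)"
proof
  have sq: "integrable M (\<lambda>x. (f x)\<^sup>2)" and m: "f \<in> borel_measurable M" if f: "f \<in> S" for f
  proof -
    show [measurable]: "f \<in> borel_measurable M"
      using borel_measurable_continuous_onI[OF rkhs_stein_kernel_continuous[OF S f psi]]
        measurable_cong_sets[OF M refl] by blast
    show "integrable M (\<lambda>x. (f x)\<^sup>2)"
    proof (rule Bochner_Integration.integrable_bound)
      show "integrable M (\<lambda>x. ip f f * stein_kernel psi x x)" using int by simp
      have "\<bar>(f x)\<^sup>2\<bar> \<le> \<bar>ip f f * stein_kernel psi x x\<bar>" for x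
        using rkhs_stein_kernel_bounds(1)[OF S f, of x] by simp
      then show "AE x in M. norm ((f x)\<^sup>2) \<le> norm (ip f f * stein_kernel psi x x)" by simp
    qed measurable
  qed
  then show "S \<subseteq> square_integrable M" by (auto simp: square_integrable_def)
  fix f assume f: "f \<in> S"
  have "(\<integral>x. (f x)\<^sup>2 \<partial>M) \<le> (\<integral>x. ip f f * stein_kernel psi x x \<partial>M)"
    using sq[OF f] int rkhs_stein_kernel_bounds(1)[OF S f] by (intro integral_mono) auto
  then show "(\<integral>x. (f x)\<^sup>2 \<partial>M) \<le> (\<integral>x. stein_kernel psi x x \<partial>M) * ip f f"
    by (simp add: mult.commute)
qed (rule S)

section \<open>The weighted mean of the Stein map and the discrepancy\<close>

text \<open>The integrable kernel diagonal dominates the squares of all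
  \<open>inner (psi x) h\<close> up to the factor \<open>inner h h\<close>, so integration against
  \<open>u\<close> is a bounded functional of \<open>h\<close>; \<open>m\<close> is its Riesz
  representer, the weak integral of \<open>psi\<close> weighted by \<open>u\<close>.\<close>

lemma weak_weighted_mean_exists:
  fixes psi :: "'x::topological_space \<Rightarrow> 'h::{real_inner, complete_space}"
  assumes psi: "continuous_on UNIV psi" and M: "sets M = sets borel"
    and int: "integrable M (\<lambda>x. stein_kernel psi x x)" and u: "u \<in> square_integrable M"
  obtains m where "\<And>h. integrable M (\<lambda>x. inner (psi x) h * u x)"
    and "\<And>h. (\<integral>x. inner (psi x) h * u x \<partial>M) = inner h m"
proof -
  interpret L2: semi_inner_space "\<lambda>c f x. c * f x" "square_integrable M" "\<lambda>f g. \<integral>x. f x * g x \<partial>M"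
    by (rule semi_inner_space_square_integrable)
  interpret H: complete_semi_inner_space scaleR "UNIV :: 'h set" inner
    by (rule complete_semi_inner_space_UNIV)
  have bnd: "(inner (psi x) h)\<^sup>2 \<le> inner h h * stein_kernel psi x x" for x h
    using Cauchy_Schwarz_ineq[of "psi x" h] by (simp add: stein_kernel_def mult.commute)
  have sq: "(\<lambda>x. inner (psi x) h) \<in> square_integrable M" for h
  proof -
    have "continuous_on UNIV (\<lambda>x. inner (psi x) h)" using psi by (intro continuous_intros)
    then have [measurable]: "(\<lambda>x. inner (psi x) h) \<in> borel_measurable M"
      using borel_measurable_continuous_onI measurable_cong_sets[OF M refl] by blast
    have "integrable M (\<lambda>x. (inner (psi x) h)\<^sup>2)"
    proof (rule Bochner_Integration.integrable_bound)
      show "integrable M (\<lambda>x. inner h h * stein_kernel psi x x)" using int by simp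
      have "\<bar>(inner (psi x) h)\<^sup>2\<bar> \<le> \<bar>inner h h * stein_kernel psi x x\<bar>" for x
        using bnd[of x h] by simp
      then show "AE x in M. norm ((inner (psi x) h)\<^sup>2) \<le> norm (inner h h * stein_kernel psi x x)"
        by simp
    qed measurable
    then show ?thesis by (simp add: square_integrable_def)
  qed
  have "\<exists>m\<in>UNIV. \<forall>h\<in>UNIV. (\<integral>x. inner (psi x) h * u x \<partial>M) = inner h m"
  proof (rule H.Riesz_representation)
    fix f g :: 'h and c :: real
    show "(\<integral>x. inner (psi x) (f + g) * u x \<partial>M) =
        (\<integral>x. inner (psi x) f * u x \<partial>M) + (\<integral>x. inner (psi x) g * u x \<partial>M)"
      using L2.ip_add_left[OF sq[of f] sq[of g] u] by (simp add: inner_add_right)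
    show "(\<integral>x. inner (psi x) (c *\<^sub>R f) * u x \<partial>M) = c * (\<integral>x. inner (psi x) f * u x \<partial>M)"
      using L2.ip_scale_left[OF sq[of f] u] by simp
    have "(\<integral>x. inner (psi x) f * u x \<partial>M)\<^sup>2
        \<le> (\<integral>x. inner (psi x) f * inner (psi x) f \<partial>M) * (\<integral>x. u x * u x \<partial>M)"
      using L2.ip_Cauchy_Schwarz[OF sq u] .
    also have "\<dots> \<le> (\<integral>x. inner f f * stein_kernel psi x x \<partial>M) * (\<integral>x. u x * u x \<partial>M)"
      using bnd sq[of f] int L2.ip_nonneg[OF u]
      by (intro mult_right_mono integral_mono) (auto simp: square_integrable_def power2_eq_square)
    finally show "(\<integral>x. inner (psi x) f * u x \<partial>M)\<^sup>2
        \<le> ((\<integral>x. stein_kernel psi x x \<partial>M) * (\<integral>x. u x * u x \<partial>M)) * inner f f"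
      by (simp add: mult_ac)
  qed
  then show thesis using that square_integrable_mult[OF sq u] by blast
qed

lemma SUP_unit_ball_abs_inner:
  "(SUP h\<in>{h. norm h \<le> 1}. \<bar>inner h m\<bar>) = norm (m :: 'h::real_inner)"
proof (rule cSup_eq_maximum)
  show "norm m \<in> (\<lambda>h. \<bar>inner h m\<bar>) ` {h. norm h \<le> 1}"
  proof (rule image_eqI)
    \<comment> \<open>Normalising \<open>m\<close> attains the supremum; for \<open>m = 0\<close>
      the witness \<open>sgn m\<close> is 0 and both sides vanish.\<close>
    show "norm m = \<bar>inner (sgn m) m\<bar>"
      by (cases "m = 0") (simp_all add: sgn_div_norm power2_eq_square flip: power2_norm_eq_inner)
  qed (simp add: norm_sgn)
  fix a assume "a \<in> (\<lambda>h. \<bar>inner h m\<bar>) ` {h. norm h \<le> 1}"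
  then obtain h where "norm h \<le> 1" "a = \<bar>inner h m\<bar>" by auto
  then show "a \<le> norm m"
    using Cauchy_Schwarz_ineq2[of h m] mult_right_mono[of "norm h" 1 "norm m"] by simp
qed

theorem proposition1:
  fixes psi :: "'x::second_countable_topology \<Rightarrow> 'h::{real_inner, complete_space}"
    and P0 P :: "'x measure"
    and S :: "('x \<Rightarrow> real) set"
    and ip :: "('x \<Rightarrow> real) \<Rightarrow> ('x \<Rightarrow> real) \<Rightarrow> real"
    and I :: "nat set"
    and lam :: "nat \<Rightarrow> real"
    and phi :: "nat \<Rightarrow> 'x \<Rightarrow> real"
    and u :: "'x \<Rightarrow> real"
  assumes "prob_space P0" and "sets P0 = sets borel"
    and "has_mean P0 psi 0"
    and "continuous_on UNIV (\<lambda>(x, y). stein_kernel psi x y)"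
    and "integrable P0 (\<lambda>x. stein_kernel psi x x)"
    and "is_rkhs (stein_kernel psi) S ip"
    and "positive_eigensystem P0 (Upsilon S ip P0) I lam phi"
    and "prob_space P" and "sets P = sets borel"
    and "absolutely_continuous P0 P"
    and "u = (\<lambda>x. enn2real (RN_deriv P0 P x) - 1)"
    and "u \<in> square_integrable P0"
  shows "(KSD psi P)\<^sup>2 = ip (incl_adj S ip P0 (L2_class P0 u)) (incl_adj S ip P0 (L2_class P0 u))
    \<and> ip (incl_adj S ip P0 (L2_class P0 u)) (incl_adj S ip P0 (L2_class P0 u))
        = L2_inner P0 (Upsilon S ip P0 (L2_class P0 u)) (L2_class P0 u)
    \<and> ((\<lambda>i. lam i * (L2_inner P0 (L2_class P0 u) (L2_class P0 (phi i)))\<^sup>2)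
        has_sum L2_inner P0 (Upsilon S ip P0 (L2_class P0 u)) (L2_class P0 u)) I"
proof -
  interpret P0: prob_space P0 by fact
  interpret P: prob_space P by fact
  note u = assms(12)
  have psi: "continuous_on UNIV psi" using assms(4) by (rule continuous_feature_map)
  interpret L2_rkhs P0 "stein_kernel psi" S ip "\<integral>x. stein_kernel psi x x \<partial>P0"
    by (rule L2_rkhs_stein_kernel[OF assms(6) psi assms(2,5)])
  obtain m where int_m: "\<And>h. integrable P0 (\<lambda>x. inner (psi x) h * u x)"
    and m: "\<And>h. (\<integral>x. inner (psi x) h * u x \<partial>P0) = inner h m"
    using weak_weighted_mean_exists[OF psi assms(2,5) u] by blast
  \<comment> \<open>The density is \<open>1 + u\<close>; its constant part contributes the mean
    under \<open>P0\<close>, which is zero.\<close>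
  have mean_P: "(\<integral>x. inner (psi x) h \<partial>P) = inner h m" for h
  proof -
    have mean0: "integrable P0 (\<lambda>x. inner (psi x) h)" "(\<integral>x. inner (psi x) h \<partial>P0) = 0"
      using assms(3) by (simp_all add: has_mean_def)
    have "(\<integral>x. inner (psi x) h \<partial>P) = (\<integral>x. enn2real (RN_deriv P0 P x) * inner (psi x) h \<partial>P0)"
      using mean0(1) assms(2,9)
      by (intro P0.RN_deriv_integral[OF P.sigma_finite_measure_axioms assms(10)]) auto
    also have "\<dots> = (\<integral>x. inner (psi x) h + inner (psi x) h * u x \<partial>P0)"
      by (simp add: assms(11) algebra_simps)
    also have "\<dots> = inner h m" using mean0 int_m m by simp
    finally show ?thesis .
  qed
  \<comment> \<open>The kernel section at \<open>x\<close> is \<open>inner (psi y) h\<close> with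
    \<open>h = psi x\<close>, so \<open>m\<close> evaluates the integral.\<close>
  have "Jadj u x = inner (psi x) m" for x
    using incl_adj_apply[OF u, of x] m[of "psi x"] by (simp add: stein_kernel_def)
  \<comment> \<open>Now \<open>h = m\<close>: the pairing of \<open>Jadj u\<close> with
    \<open>u\<close> is the functional represented by \<open>m\<close>, evaluated at
    \<open>m\<close> itself.\<close>
  then have "ip (Jadj u) (Jadj u) = inner m m"
    using incl_adj_inner[OF u incl_adj_mem[OF u]] m[of m] by simp
  moreover have "KSD psi P = norm m" by (simp add: KSD_def mean_P SUP_unit_ball_abs_inner)
  ultimately have "(KSD psi P)\<^sup>2 = ip (Jadj u) (Jadj u)" by (simp add: power2_norm_eq_inner)
  then show ?thesis
    using Upsilon_inner[OF u u] Upsilon_quadratic_form_has_sum[OF u assms(7)] by simp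
qed

end
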